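(* There exists $s_2\in(s_1,\infty)$ such that the following holds true: (a) For every $s\in\mathbb R$ with $s\le s_2$, we have $f_s(y)=g_s(y)$ for all $y\ge0$. (b) For every $s>s_2$, the set $J_s=\{y\in\mathbb R_+:\ f_s(y)<g_s(y)\}$ is non-empty and contained in some interval $(a_s,b_s)$ with $0<a_s<b_s<\infty$.
   Context: Notation: $\mathbb N=\{1,2,\ldots\}$, $\mathbb N_0=\mathbb N\cup\{0\}$, $\mathbb R_+=[0,\infty)$. Fix $\alpha\in(0,1)$, let $c=1/\sum_{k\in\mathbb N_0}\exp(-k^\alpha)$, $\gamma=1/(2-\alpha)$, and let $\sigma^2>0$ be the variance of an $\mathbb N_0$-valued random variable $X$ with $\mathbb P(X=k)=c\exp(-k^\alpha)$, $k\in\mathbb N_0$. Let $\mathcal D\subset\mathbb R_+^{\mathbb N}$ be the set of decreasing sequences $x_1\ge x_2\ge\cdots$ (of numbers in $\mathbb R_+$). For $s\in\mathbb R$ define $F_s:\mathcal D\to\mathbb R_+\cup\{\infty\}$ by $$F_s(x_1,x_2,\ldots)=\sum_{j=1}^\infty x_j^\alpha+\frac1{2\sigma^2}\Bigl(s-\sum_{j=1}^\infty x_j\Bigr)^2$$ (equal to $\infty$ if one of the sums diverges), $f_s(y)=\inf\{F_s(x_1,x_2,\ldots):\ (x_j)_{j\in\mathbb N}\in\mathcal D,\ x_1=y\}$ and $g_s(y)=y^\alpha+\frac1{2\sigma^2}(s-y)^2$ for $y\in\mathbb R_+$. Finally $$s_1=\frac1\gamma(\sigma^2)^\gamma(2-2\alpha)^{\gamma-1}.$$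 *)

theory Defs
  imports
    "HOL-Probability.Probability"
    "HOL-Real_Asymp.Real_Asymp"
begin

definition norm_const :: "real \<Rightarrow> real" where
  "norm_const \<alpha> = 1 / (\<Sum>k. exp (- (real k powr \<alpha>)))"

definition gam :: "real \<Rightarrow> real" where
  "gam \<alpha> = 1 / (2 - \<alpha>)"

definition X_pmf :: "real \<Rightarrow> nat pmf" where
  "X_pmf \<alpha> = embed_pmf (\<lambda>k. norm_const \<alpha> * exp (- (real k powr \<alpha>)))"

definition sigma_sq :: "real \<Rightarrow> real" where
  "sigma_sq \<alpha> = measure_pmf.variance (X_pmf \<alpha>) real"

lemma summable_weights:
  fixes \<alpha> :: real
  assumes "0 < \<alpha>"
  shows "summable (\<lambda>k. real k ^ n * exp (- (real k powr \<alpha>)))"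
proof (rule summable_comparison_test_bigo)
  show "summable (\<lambda>k. norm (real k powr -2))"
    by (simp add: summable_real_powr_iff)
  show "(\<lambda>k. real k ^ n * exp (- (real k powr \<alpha>))) \<in> O(\<lambda>k. real k powr -2)"
    using assms by real_asymp
qed

lemma norm_const_pos:
  assumes "0 < \<alpha>"
  shows "norm_const \<alpha> > 0"
proof -
  have "summable (\<lambda>k. exp (- (real k powr \<alpha>)))"
    using summable_weights[OF assms, of 0] by simp
  then show ?thesis
    unfolding norm_const_def by (simp add: suminf_pos)
qed

text \<open>
  The next lemmas confirm that the weights do define a probability distribution on the
  naturals, and that the variance above is genuine (finite) and positive.
\<close>

lemma pmf_X_pmf:
  assumes "0 < \<alpha>"
  shows "pmf (X_pmf \<alpha>) k = norm_const \<alpha> * exp (- (real k powr \<alpha>))"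
proof -
  have S: "summable (\<lambda>k. exp (- (real k powr \<alpha>)))"
    using summable_weights[OF assms, of 0] by simp
  note c = norm_const_pos[OF assms]
  have pos: "(\<Sum>k. exp (- (real k powr \<alpha>))) > 0"
    using S by (intro suminf_pos) auto
  have "(\<integral>\<^sup>+k. ennreal (norm_const \<alpha> * exp (- (real k powr \<alpha>))) \<partial>count_space UNIV)
      = (\<Sum>k. ennreal (norm_const \<alpha> * exp (- (real k powr \<alpha>))))"
    by (rule nn_integral_count_space_nat)
  also have "\<dots> = ennreal (\<Sum>k. norm_const \<alpha> * exp (- (real k powr \<alpha>)))"
    using c S by (intro suminf_ennreal2) (auto intro!: summable_mult)
  also have "(\<Sum>k. norm_const \<alpha> * exp (- (real k powr \<alpha>))) = 1"
    using pos suminf_mult[OF S, of "norm_const \<alpha>"] by (simp add: norm_const_def)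
  finally show ?thesis
    unfolding X_pmf_def using c by (intro pmf_embed_pmf) (auto simp: less_imp_le)
qed

lemma integrable_X_pmf_power:
  assumes "0 < \<alpha>"
  shows "integrable (measure_pmf (X_pmf \<alpha>)) (\<lambda>k. real k ^ n)"
proof -
  have "summable (\<lambda>k. norm_const \<alpha> * (real k ^ n * exp (- (real k powr \<alpha>))))"
    by (intro summable_mult summable_weights assms)
  then have "integrable (count_space UNIV) (\<lambda>k. pmf (X_pmf \<alpha>) k *\<^sub>R (real k ^ n))"
    using norm_const_pos[OF assms]
    by (simp add: integrable_count_space_nat_iff pmf_X_pmf[OF assms] abs_mult mult_ac)
  then show ?thesis
    unfolding measure_pmf_eq_density by (subst integrable_density) auto
qed

lemma sigma_sq_pos:
  assumes "0 < \<alpha>"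
  shows "sigma_sq \<alpha> > 0"
proof -
  define \<mu> where "\<mu> = measure_pmf.expectation (X_pmf \<alpha>) real"
  note int = integrable_X_pmf_power[OF assms]
  have I: "integrable (measure_pmf (X_pmf \<alpha>)) (\<lambda>k. (real k - \<mu>)\<^sup>2)"
    using int[of 1] int[of 2] by (simp add: power2_diff)
  have supp: "k \<in> set_pmf (X_pmf \<alpha>)" for k
    using norm_const_pos[OF assms] by (simp add: set_pmf_iff pmf_X_pmf[OF assms])
  have "sigma_sq \<alpha> = measure_pmf.expectation (X_pmf \<alpha>) (\<lambda>k. (real k - \<mu>)\<^sup>2)"
    by (simp add: sigma_sq_def \<mu>_def)
  moreover have "\<dots> \<noteq> 0"
  proof
    assume "measure_pmf.expectation (X_pmf \<alpha>) (\<lambda>k. (real k - \<mu>)\<^sup>2) = 0"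
    then have "AE k in X_pmf \<alpha>. (real k - \<mu>)\<^sup>2 = 0"
      by (subst (asm) integral_nonneg_eq_0_iff_AE[OF I]) auto
    then have "real 0 = \<mu>" and "real 1 = \<mu>"
      using supp[of 0] supp[of 1] by (force simp: AE_measure_pmf_iff)+
    then show False by simp
  qed
  moreover have "0 \<le> measure_pmf.expectation (X_pmf \<alpha>) (\<lambda>k. (real k - \<mu>)\<^sup>2)"
    by simp
  ultimately show ?thesis by linarith
qed

text \<open>Sequences are indexed from 0, so \<open>x 0\<close> is the leading term \<open>x\<^sub>1\<close> of the
  mathematical notation.\<close>

definition decr_seqs :: "(nat \<Rightarrow> real) set" where
  "decr_seqs = {x. decseq x \<and> (\<forall>j. 0 \<le> x j)}"

definition F_s :: "real \<Rightarrow> real \<Rightarrow> (nat \<Rightarrow> real) \<Rightarrow> ereal" where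
  "F_s \<alpha> s x =
    (if summable (\<lambda>j. x j powr \<alpha>) \<and> summable x
     then ereal ((\<Sum>j. x j powr \<alpha>) + 1 / (2 * sigma_sq \<alpha>) * (s - (\<Sum>j. x j))\<^sup>2)
     else \<infinity>)"

definition f_s :: "real \<Rightarrow> real \<Rightarrow> real \<Rightarrow> ereal" where
  "f_s \<alpha> s y = (INF x \<in> {x \<in> decr_seqs. x 0 = y}. F_s \<alpha> s x)"

definition g_s :: "real \<Rightarrow> real \<Rightarrow> real \<Rightarrow> real" where
  "g_s \<alpha> s y = y powr \<alpha> + 1 / (2 * sigma_sq \<alpha>) * (s - y)\<^sup>2"

definition s1 :: "real \<Rightarrow> real" where
  "s1 \<alpha> = 1 / gam \<alpha> * sigma_sq \<alpha> powr gam \<alpha> * (2 - 2 * \<alpha>) powr (gam \<alpha> - 1)"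

definition J_s :: "real \<Rightarrow> real \<Rightarrow> real set" where
  "J_s \<alpha> s = {y. 0 \<le> y \<and> f_s \<alpha> s y < ereal (g_s \<alpha> s y)}"

end

theory Submission
  imports Defs
begin

text \<open>
  Write \<open>y\<close> for the leading term, \<open>T > 0\<close> for the sum of the remaining terms and \<open>A\<close> for the sum
  of their \<open>\<alpha>\<close>-th powers. Expanding the square, \<open>F\<^sub>s(x) < g\<^sub>s(y)\<close> becomes
  \<open>y + T / 2 + \<sigma>\<^sup>2 A / T < s\<close>, whose left-hand side does not depend on \<open>s\<close>; so \<open>s\<^sub>2\<close> is the
  infimum of that left-hand side. If all remaining terms are at most \<open>M\<close>, then
  \<open>A \<ge> M\<^bsup>\<alpha> - 1\<^esup> T\<close>. Taking \<open>M = T\<close> and minimising over \<open>T\<close> bounds the left-hand side below by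
  \<open>y + s\<^sub>1\<close>; taking \<open>M = y\<close> bounds it below by \<open>\<sigma>\<^sup>2 y\<^bsup>\<alpha> - 1\<^esup>\<close>, which is large for small \<open>y\<close>.
\<close>

text \<open>The only sequences that can beat \<open>g_s\<close>: outside this set a decreasing
  sequence has \<open>F_s\<close> infinite or a zero tail, where \<open>F_s\<close> equals
  \<open>g_s\<close>. A positive tail sum also makes the quotient in \<open>threshold\<close>
  genuine.\<close>

definition tail_seqs :: "real \<Rightarrow> (nat \<Rightarrow> real) set" where
  "tail_seqs \<alpha> = {x \<in> decr_seqs. summable (\<lambda>j. x j powr \<alpha>) \<and> summable x \<and> 0 < (\<Sum>j. x (Suc j))}"

definition threshold :: "real \<Rightarrow> (nat \<Rightarrow> real) \<Rightarrow> real" where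
  "threshold \<alpha> x = x 0 + (\<Sum>j. x (Suc j)) / 2
     + sigma_sq \<alpha> * (\<Sum>j. x (Suc j) powr \<alpha>) / (\<Sum>j. x (Suc j))"

text \<open>Termwise, u^\<alpha> = u^(\<alpha> - 1) u, and the exponent \<alpha> - 1 is negative, so
  the first factor is smallest at the upper bound \<open>M\<close>.\<close>

lemma powr_sum_ge:
  fixes u :: "nat \<Rightarrow> real"
  assumes "\<alpha> < 1" and nonneg: "\<And>j. 0 \<le> u j" and le: "\<And>j. u j \<le> M"
    and sum: "summable u" "summable (\<lambda>j. u j powr \<alpha>)"
  shows "M powr (\<alpha> - 1) * (\<Sum>j. u j) \<le> (\<Sum>j. u j powr \<alpha>)"
proof -
  have "M powr (\<alpha> - 1) * u j \<le> u j powr \<alpha>" for j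
  \<comment> \<open>Zero terms are separate because \<open>0 powr (\<alpha> - 1)\<close> is 0, which
    breaks monotonicity of the power.\<close>
  proof (cases "u j = 0")
    case False
    then have "0 < u j" using nonneg[of j] by simp
    then have "M powr (\<alpha> - 1) \<le> u j powr (\<alpha> - 1)"
      using assms(1) le[of j] by (intro powr_mono2') auto
    then have "M powr (\<alpha> - 1) * u j \<le> u j powr (\<alpha> - 1) * u j"
      using \<open>0 < u j\<close> by simp
    also have "\<dots> = u j powr \<alpha>"
      using \<open>0 < u j\<close> by (simp add: powr_diff)
    finally show ?thesis .
  qed simp
  then have "(\<Sum>j. M powr (\<alpha> - 1) * u j) \<le> (\<Sum>j. u j powr \<alpha>)"
    by (intro suminf_le summable_mult sum)
  then show ?thesis by (simp add: suminf_mult sum)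
qed

text \<open>The tangent line at r = 1 of a convex power; it replaces calculus in the minimisation
  over the tail sum.\<close>

lemma Bernoulli_powr_neg:
  fixes r p :: real
  assumes "0 < r" "p \<le> 0"
  shows "1 + p * (r - 1) \<le> r powr p"
proof -
  have "p * (r - 1) \<le> p * ln r"
    using assms by (intro mult_left_mono_neg ln_le_minus_one)
  moreover have "1 + p * ln r \<le> exp (p * ln r)"
    by (rule exp_ge_add_one_self)
  moreover have "r powr p = exp (p * ln r)"
    using assms by (simp add: powr_def)
  ultimately show ?thesis by linarith
qed

text \<open>\<open>s1\<close> is the minimum of the right-hand side over \<open>T\<close>, obtained
  by bounding the power below by its tangent at the minimiser.\<close>

lemma s1_le:
  assumes "0 < \<alpha>" "\<alpha> < 1" "0 < T"
  shows "s1 \<alpha> \<le> T / 2 + sigma_sq \<alpha> * T powr (\<alpha> - 1)"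
proof -
  define v where "v = sigma_sq \<alpha>"
  define b where "b = 2 - 2 * \<alpha>"
  \<comment> \<open>the minimiser of the right-hand side\<close>
  define T0 where "T0 = (b * v) powr gam \<alpha>"
  have pos: "0 < v" "0 < b" "0 < T0"
    using assms sigma_sq_pos[of \<alpha>] by (auto simp: v_def b_def T0_def)
  have "T0 powr (2 - \<alpha>) = b * v"
    using assms pos by (simp add: T0_def powr_powr gam_def)
  moreover have "T0 powr (2 - \<alpha>) * T0 powr (\<alpha> - 1) = T0"
    using pos by (simp flip: powr_add)
  \<comment> \<open>This is the stationarity condition at \<open>T0\<close>.\<close>
  ultimately have v: "v * T0 powr (\<alpha> - 1) = T0 / b"
    using pos by (simp add: field_simps)
  have "s1 \<alpha> = (2 - \<alpha>) * (v powr gam \<alpha> * (b powr gam \<alpha> / b))"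
    using assms pos by (simp add: s1_def gam_def v_def b_def powr_diff)
  also have "\<dots> = T0 / b * (2 - \<alpha>)"
    using pos by (simp add: T0_def powr_mult)
  \<comment> \<open>Since b = 2 (1 - \<alpha>), the slope of the tangent cancels that of
    \<open>T / 2\<close>, so the expression is constant in \<open>T\<close>.\<close>
  also have "\<dots> = T / 2 + T0 / b * (1 + (\<alpha> - 1) * (T / T0 - 1))"
    using pos assms by (simp add: field_simps b_def)
  also have "\<dots> \<le> T / 2 + T0 / b * (T / T0) powr (\<alpha> - 1)"
    using pos assms by (intro add_left_mono mult_left_mono Bernoulli_powr_neg) auto
  also have "\<dots> = T / 2 + v * (T0 powr (\<alpha> - 1) * (T / T0) powr (\<alpha> - 1))"
    by (simp flip: v)
  also have "T0 powr (\<alpha> - 1) * (T / T0) powr (\<alpha> - 1) = T powr (\<alpha> - 1)"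
    using pos assms by (simp flip: powr_mult)
  finally show ?thesis by (simp add: v_def)
qed

lemma tail_seqsD:
  assumes "x \<in> tail_seqs \<alpha>"
  shows "\<And>j. 0 \<le> x j" "\<And>j. x (Suc j) \<le> x 0" "0 < (\<Sum>j. x (Suc j))"
    "summable (\<lambda>j. x (Suc j))" "summable (\<lambda>j. x (Suc j) powr \<alpha>)"
proof -
  show "0 \<le> x j" "x (Suc j) \<le> x 0" "0 < (\<Sum>j. x (Suc j))" for j
    using assms by (auto simp: tail_seqs_def decr_seqs_def decseq_def)
  show "summable (\<lambda>j. x (Suc j))" "summable (\<lambda>j. x (Suc j) powr \<alpha>)"
    using assms summable_Suc_iff[of x] summable_Suc_iff[of "\<lambda>j. x j powr \<alpha>"]
    by (auto simp: tail_seqs_def)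
qed

text \<open>The second bound compares with \<open>s1\<close>, the third caps the leading term from
  above, and the fourth keeps it away from 0.\<close>

lemma threshold_ge:
  assumes "0 < \<alpha>" "\<alpha> < 1" and x: "x \<in> tail_seqs \<alpha>"
  shows "0 < x 0" "x 0 + s1 \<alpha> \<le> threshold \<alpha> x" "x 0 < threshold \<alpha> x"
    "sigma_sq \<alpha> * x 0 powr (\<alpha> - 1) < threshold \<alpha> x"
proof -
  note x' = tail_seqsD[OF x]
  define T where "T = (\<Sum>j. x (Suc j))"
  define A where "A = (\<Sum>j. x (Suc j) powr \<alpha>)"
  note v = sigma_sq_pos[OF assms(1)]
  have T: "0 < T" using x' by (simp add: T_def)
  have th: "threshold \<alpha> x = x 0 + T / 2 + sigma_sq \<alpha> * A / T"
    by (simp add: threshold_def T_def A_def)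
  have key: "sigma_sq \<alpha> * M powr (\<alpha> - 1) \<le> sigma_sq \<alpha> * A / T" if "\<And>j. x (Suc j) \<le> M" for M
  proof -
    have "M powr (\<alpha> - 1) * T \<le> A"
      unfolding T_def A_def using x' that assms by (intro powr_sum_ge) auto
    then have "M powr (\<alpha> - 1) \<le> A / T"
      using T by (simp add: field_simps)
    then show ?thesis
      using v by (metis less_imp_le mult_left_mono times_divide_eq_right)
  qed
  show pos: "0 < x 0"
  proof (rule ccontr)
    assume "\<not> 0 < x 0"
    then have "x (Suc j) = 0" for j
      using x'(1)[of "Suc j"] x'(2)[of j] by simp
    then show False using T by (simp add: T_def)
  qed
  have "x (Suc j) \<le> T" for j
    unfolding T_def using sum_le_suminf[OF x'(4), of "{j}"] x'(1) by simp
  from key[OF this] s1_le[OF assms(1,2) T] show "x 0 + s1 \<alpha> \<le> threshold \<alpha> x"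
    by (simp add: th)
  have "0 < sigma_sq \<alpha> * x 0 powr (\<alpha> - 1)"
    using v pos by simp
  with key[OF x'(2)] T pos
  show "x 0 < threshold \<alpha> x" "sigma_sq \<alpha> * x 0 powr (\<alpha> - 1) < threshold \<alpha> x"
    by (simp_all add: th)
qed

text \<open>As functions of \<open>s\<close>, both sides have the same quadratic term, so for finite
  \<open>F_s\<close> the difference is affine in \<open>s\<close> with slope T / v \<ge> 0.\<close>

lemma F_s_less_g_s_iff:
  assumes "0 < \<alpha>" and x: "x \<in> decr_seqs"
  shows "F_s \<alpha> s x < ereal (g_s \<alpha> s (x 0)) \<longleftrightarrow> x \<in> tail_seqs \<alpha> \<and> threshold \<alpha> x < s"
proof (cases "summable (\<lambda>j. x j powr \<alpha>) \<and> summable x")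
  case False
  then show ?thesis by (auto simp: F_s_def tail_seqs_def)
next
  case sum: True
  define T where "T = (\<Sum>j. x (Suc j))"
  define A where "A = (\<Sum>j. x (Suc j) powr \<alpha>)"
  define v where "v = sigma_sq \<alpha>"
  have v: "0 < v" using sigma_sq_pos assms(1) by (simp add: v_def)
  have nn: "0 \<le> x j" for j using x by (simp add: decr_seqs_def)
  have "summable (\<lambda>j. x (Suc j))" "summable (\<lambda>j. x (Suc j) powr \<alpha>)"
    using sum summable_Suc_iff[of x] summable_Suc_iff[of "\<lambda>j. x j powr \<alpha>"] by auto
  then have T: "0 \<le> T" and A: "0 \<le> A"
    unfolding T_def A_def using nn by (auto intro!: suminf_nonneg)
  have "(\<Sum>j. x j) = x 0 + T" "(\<Sum>j. x j powr \<alpha>) = x 0 powr \<alpha> + A"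
    using sum suminf_split_head[of x] suminf_split_head[of "\<lambda>j. x j powr \<alpha>"]
    by (auto simp: T_def A_def)
  then have "F_s \<alpha> s x < ereal (g_s \<alpha> s (x 0)) \<longleftrightarrow>
      A + 1 / (2 * v) * (s - (x 0 + T))\<^sup>2 < 1 / (2 * v) * (s - x 0)\<^sup>2"
    using sum by (simp add: F_s_def g_s_def v_def)
  also have "\<dots> \<longleftrightarrow> 0 < (2 * T * s - (2 * v * A + T\<^sup>2 + 2 * T * x 0)) / (2 * v)"
  proof -
    have "1 / (2 * v) * (s - x 0)\<^sup>2 - (A + 1 / (2 * v) * (s - (x 0 + T))\<^sup>2) =
        (2 * T * s - (2 * v * A + T\<^sup>2 + 2 * T * x 0)) / (2 * v)"
      using v by (simp add: field_simps power2_eq_square)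
    then show ?thesis by linarith
  qed
  also have "\<dots> \<longleftrightarrow> 2 * v * A + T\<^sup>2 + 2 * T * x 0 < 2 * T * s"
    using v by (simp add: zero_less_divide_iff)
  \<comment> \<open>For T = 0 the inequality would say 2 v A < 0, which is impossible; otherwise
    divide by 2 T.\<close>
  also have "\<dots> \<longleftrightarrow> 0 < T \<and> x 0 + T / 2 + v * A / T < s"
  proof (cases "T = 0")
    case True
    then show ?thesis using v A by (simp add: not_less)
  next
    case False
    then show ?thesis using T by (simp add: field_simps power2_eq_square)
  qed
  finally show ?thesis
    using sum x by (simp add: tail_seqs_def threshold_def T_def A_def v_def)
qed

lemma f_s_less_g_s_iff:
  assumes "0 < \<alpha>"
  shows "f_s \<alpha> s y < ereal (g_s \<alpha> s y) \<longleftrightarrow> (\<exists>x \<in> tail_seqs \<alpha>. x 0 = y \<and> threshold \<alpha> x < s)"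
proof -
  have "f_s \<alpha> s y < ereal (g_s \<alpha> s y) \<longleftrightarrow>
      (\<exists>x \<in> decr_seqs. x 0 = y \<and> F_s \<alpha> s x < ereal (g_s \<alpha> s y))"
    by (auto simp: f_s_def INF_less_iff)
  then show ?thesis
    using F_s_less_g_s_iff[OF assms] by (auto simp: tail_seqs_def)
qed

text \<open>The sequence y, 0, 0, ... has value exactly \<open>g_s\<close>. Hence equality in part
  (a) only requires excluding strict inequality.\<close>

lemma f_s_le_g_s:
  assumes "0 \<le> y"
  shows "f_s \<alpha> s y \<le> ereal (g_s \<alpha> s y)"
proof -
  define x :: "nat \<Rightarrow> real" where "x = (\<lambda>j. if j = 0 then y else 0)"
  have "x \<in> decr_seqs" "x 0 = y"
    using assms by (auto simp: x_def decr_seqs_def decseq_def)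
  moreover have "x sums y"
    using sums_single[of 0 "\<lambda>_. y"] by (simp add: x_def)
  moreover have "(\<lambda>j. x j powr \<alpha>) sums (y powr \<alpha>)"
  proof -
    have "(\<lambda>j. x j powr \<alpha>) = (\<lambda>j. if j = 0 then y powr \<alpha> else 0)"
      by (auto simp: x_def)
    then show ?thesis using sums_single[of 0 "\<lambda>_. y powr \<alpha>"] by simp
  qed
  ultimately have "F_s \<alpha> s x = ereal (g_s \<alpha> s y)"
    by (auto simp: F_s_def g_s_def sums_iff)
  then show ?thesis
    unfolding f_s_def using \<open>x \<in> decr_seqs\<close> \<open>x 0 = y\<close> by (intro INF_lower2[of x]) auto
qed

text \<open>Makes the real infimum defining \<open>s2\<close> meaningful; the witness is 1, 1, 0, 0,
  ...\<close>

lemma tail_seqs_nonempty: "tail_seqs \<alpha> \<noteq> {}"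
proof -
  define x :: "nat \<Rightarrow> real" where "x = (\<lambda>j. if j \<le> 1 then 1 else 0)"
  have "(\<lambda>j. x (Suc j)) sums 1"
    using sums_single[of 0 "\<lambda>_. 1 :: real"] by (simp add: x_def)
  moreover have "summable x" "summable (\<lambda>j. x j powr \<alpha>)"
    by (rule summable_finite[of "{..1}"]; simp add: x_def)+
  ultimately have "x \<in> tail_seqs \<alpha>"
    by (auto simp: tail_seqs_def decr_seqs_def decseq_def sums_iff x_def)
  then show ?thesis by blast
qed

lemma powr_large_near_zero:
  fixes p K :: real
  assumes "p < 0"
  obtains a where "0 < a" "\<And>y. 0 < y \<Longrightarrow> y \<le> a \<Longrightarrow> K \<le> y powr p"
proof
  \<comment> \<open>The maximum with 1 gives a positive base for any sign of
    \<open>K\<close>.\<close>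
  define L where "L = max 1 K"
  have L: "1 \<le> L" "K \<le> L" by (auto simp: L_def)
  show "0 < L powr (1 / p)" using L by simp
  show "K \<le> y powr p" if "0 < y" "y \<le> L powr (1 / p)" for y
  proof -
    have "L = (L powr (1 / p)) powr p"
      using assms L by (simp add: powr_powr)
    also have "\<dots> \<le> y powr p"
      using that assms by (intro powr_mono2') auto
    finally show ?thesis using L by simp
  qed
qed

theorem theorem2p3:
  fixes \<alpha> :: real
  assumes "0 < \<alpha>" and "\<alpha> < 1"
  shows "\<exists>s2 > s1 \<alpha>.
    (\<forall>s \<le> s2. \<forall>y \<ge> 0. f_s \<alpha> s y = ereal (g_s \<alpha> s y)) \<and>
    (\<forall>s > s2. J_s \<alpha> s \<noteq> {} \<and> (\<exists>a b. 0 < a \<and> a < b \<and> J_s \<alpha> s \<subseteq> {a<..<b}))"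
proof -
  define s2 where "s2 = (INF x \<in> tail_seqs \<alpha>. threshold \<alpha> x)"
  note v = sigma_sq_pos[OF assms(1)]
  note th = threshold_ge[OF assms]
  have bdd: "bdd_below (threshold \<alpha> ` tail_seqs \<alpha>)"
    using th(1,3) by (intro bdd_belowI[of _ 0]) force
  \<comment> \<open>A bounded threshold forces a lower bound on the leading term, uniform over all
    sequences. It serves both for s1 < s2 and for the left endpoint in part (b).\<close>
  have small: "\<exists>a > 0. \<forall>x \<in> tail_seqs \<alpha>. threshold \<alpha> x \<le> K \<longrightarrow> a < x 0" for K
  proof -
    obtain a where a: "0 < a" "\<And>y. 0 < y \<Longrightarrow> y \<le> a \<Longrightarrow> K / sigma_sq \<alpha> \<le> y powr (\<alpha> - 1)"
      using powr_large_near_zero[of "\<alpha> - 1" "K / sigma_sq \<alpha>"] assms by auto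
    have "a < x 0" if "x \<in> tail_seqs \<alpha>" "threshold \<alpha> x \<le> K" for x
    proof (rule ccontr)
      assume "\<not> a < x 0"
      then have "K / sigma_sq \<alpha> \<le> x 0 powr (\<alpha> - 1)"
        using a(2) th(1) that by simp
      then have "K \<le> sigma_sq \<alpha> * x 0 powr (\<alpha> - 1)"
        using v by (simp add: field_simps)
      then show False using th(4) that by fastforce
    qed
    with a(1) show ?thesis by blast
  qed
  have "s1 \<alpha> < s2"
  proof -
    obtain a where a: "0 < a" "\<And>x. x \<in> tail_seqs \<alpha> \<Longrightarrow> threshold \<alpha> x \<le> s1 \<alpha> + 1 \<Longrightarrow> a < x 0"
      using small by blast
    \<comment> \<open>Either the threshold exceeds s1 + 1, or the leading term exceeds
      \<open>a\<close> and adds to \<open>s1\<close>. The uniform gap survives the infimum.\<close>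
    have "s1 \<alpha> + min 1 a \<le> threshold \<alpha> x" if "x \<in> tail_seqs \<alpha>" for x
      using a(2)[OF that] th(2)[OF that] by linarith
    then have "s1 \<alpha> + min 1 a \<le> s2"
      unfolding s2_def by (intro cINF_greatest tail_seqs_nonempty)
    then show ?thesis using a(1) by linarith
  qed
  moreover have "f_s \<alpha> s y = ereal (g_s \<alpha> s y)" if "s \<le> s2" "0 \<le> y" for s y
  proof -
    have "s \<le> threshold \<alpha> x" if "x \<in> tail_seqs \<alpha>" for x
      using cINF_lower[OF bdd that] \<open>s \<le> s2\<close> by (simp add: s2_def)
    then have "\<not> f_s \<alpha> s y < ereal (g_s \<alpha> s y)"
      unfolding f_s_less_g_s_iff[OF assms(1)] by (meson not_less)
    then show ?thesis using f_s_le_g_s[OF that(2)] by (meson antisym not_less)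
  qed
  moreover have "J_s \<alpha> s \<noteq> {} \<and> (\<exists>a b. 0 < a \<and> a < b \<and> J_s \<alpha> s \<subseteq> {a<..<b})" if "s2 < s" for s
  proof -
    have J: "J_s \<alpha> s = {x 0 | x. x \<in> tail_seqs \<alpha> \<and> threshold \<alpha> x < s}"
      using th(1) by (auto simp: J_s_def f_s_less_g_s_iff[OF assms(1)] intro: less_imp_le)
    obtain z where z: "z \<in> tail_seqs \<alpha>" "threshold \<alpha> z < s"
      using \<open>s2 < s\<close> unfolding s2_def cINF_less_iff[OF tail_seqs_nonempty bdd] by blast
    obtain a where a: "0 < a" "\<And>x. x \<in> tail_seqs \<alpha> \<Longrightarrow> threshold \<alpha> x \<le> s \<Longrightarrow> a < x 0"
      using small by blast
    have bounds: "a < x 0 \<and> x 0 < s" if "x \<in> tail_seqs \<alpha>" "threshold \<alpha> x < s" for x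
      using a(2)[OF that(1)] th(3)[OF that(1)] that(2) by linarith
    \<comment> \<open>The right endpoint is \<open>s\<close> itself; the witness \<open>z\<close>
      shows that the interval is nondegenerate.\<close>
    have "a < s" using bounds[OF z] by linarith
    moreover have "J_s \<alpha> s \<subseteq> {a<..<s}" "J_s \<alpha> s \<noteq> {}"
      using bounds z by (auto simp: J)
    ultimately show ?thesis using a(1) by blast
  qed
  ultimately show ?thesis by blast
qed

end
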